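(* Let $U\in U(4)$ be a two-qubit unitary and let $p_{(1)}\ge p_{(2)}\ge p_{(3)}\ge p_{(4)}\ge 0$, $\sum_{j=1}^4p_{(j)}=1$, be its normalised operator-Schmidt spectrum arranged in non-increasing order. Then $$p_{(1)}p_{(4)}\;\ge\;p_{(2)}p_{(3)}.$$ Consequently, no two-qubit unitary has operator-Schmidt rank three.
   Context: Operator-Schmidt spectrum. A two-qubit unitary $U$ on $\mathbb C^2\otimes\mathbb C^2$ has an operator-Schmidt decomposition $U=\sum_{j=1}^4\lambda_j\,A_j\otimes B_j$ with $\lambda_j\ge0$ and $\{A_j\}$, $\{B_j\}$ orthonormal bases of the $2\times2$ complex matrices for the Hilbert--Schmidt inner product $\langle A,B\rangle=\operatorname{Tr}(A^\dagger B)$. The normalised operator-Schmidt spectrum is the multiset of $p_j=\lambda_j^2/4$, which sum to $1$; the operator-Schmidt rank is the number of nonzero $p_j$. Equivalently, up to left and right multiplication by local unitaries $V_1\otimes V_2$ (which do not change the spectrum), $U$ equals $\exp[\mathrm i(\theta_1X\otimes X+\theta_2Y\otimes Y+\theta_3Z\otimes Z)]=\sum_{j=0}^3u_j\sigma_j\otimes\sigma_j$ with $\sigma_0=\mathbb I$, $\sigma_1=X$, $\sigma_2=Y$, $\sigma_3=Z$ and $|\theta_3|\le\theta_2\le\theta_1\le\pi/4$, and the spectrum is $\{|u_j|^2\}_{j=0}^3$. *)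

theory Defs
  imports "HOL-Analysis.Analysis" "HOL-Library.Multiset"
begin

definition cadjoint :: "complex^'n^'m \<Rightarrow> complex^'m^'n" where
  "cadjoint A = map_matrix cnj (transpose A)"

definition unitary :: "complex^'n^'n \<Rightarrow> bool" where
  "unitary U \<longleftrightarrow> cadjoint U ** U = mat 1 \<and> U ** cadjoint U = mat 1"

definition hs_inner :: "complex^'n^'n \<Rightarrow> complex^'n^'n \<Rightarrow> complex" where
  "hs_inner A B = trace (cadjoint A ** B)"

(* Operators on the tensor product are matrices indexed by pairs, so a two-qubit
   operator has type complex^(2 \<times> 2)^(2 \<times> 2) and no ordering of the
   product basis has to be chosen. *)
definition kron :: "complex^'n^'n \<Rightarrow> complex^'m^'m \<Rightarrow> complex^('n \<times> 'm)^('n \<times> 'm)" where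
  "kron A B = (\<chi> r c. A $ fst r $ fst c * B $ snd r $ snd c)"

(* Complex scalar multiplication of matrices is written with map_matrix, because the
   library's scalar product for vec types multiplies a vector by its entry type only. *)
definition hs_orthonormal_basis :: "(4 \<Rightarrow> complex^2^2) \<Rightarrow> bool" where
  "hs_orthonormal_basis A \<longleftrightarrow>
     (\<forall>j k. hs_inner (A j) (A k) = (if j = k then 1 else 0)) \<and>
     (\<forall>M. \<exists>c :: 4 \<Rightarrow> complex. M = (\<Sum>j\<in>UNIV. map_matrix ((*) (c j)) (A j)))"

definition op_schmidt_decomposition ::
  "complex^(2 \<times> 2)^(2 \<times> 2) \<Rightarrow> (4 \<Rightarrow> real) \<Rightarrow> (4 \<Rightarrow> complex^2^2) \<Rightarrow> (4 \<Rightarrow> complex^2^2) \<Rightarrow> bool" where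
  "op_schmidt_decomposition U l A B \<longleftrightarrow>
     (\<forall>j. l j \<ge> 0) \<and> hs_orthonormal_basis A \<and> hs_orthonormal_basis B \<and>
     U = (\<Sum>j\<in>UNIV. l j *\<^sub>R kron (A j) (B j))"

(* The decomposition is not unique, but the multiset of its coefficients is: they are
   the singular values of the realignment of U. *)
definition op_schmidt_spectrum :: "complex^(2 \<times> 2)^(2 \<times> 2) \<Rightarrow> real multiset" where
  "op_schmidt_spectrum U =
     (THE M. \<exists>l A B. op_schmidt_decomposition U l A B \<and>
        M = image_mset (\<lambda>j. (l j)\<^sup>2 / 4) (mset_set UNIV))"

definition op_schmidt_rank :: "complex^(2 \<times> 2)^(2 \<times> 2) \<Rightarrow> nat" where
  "op_schmidt_rank U = size (filter_mset (\<lambda>p. p \<noteq> 0) (op_schmidt_spectrum U))"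

(* The j-th largest element of the spectrum (with multiplicity), for j = 1, ..., 4. *)
definition op_schmidt_prob :: "complex^(2 \<times> 2)^(2 \<times> 2) \<Rightarrow> nat \<Rightarrow> real" where
  "op_schmidt_prob U j = rev (sorted_list_of_multiset (op_schmidt_spectrum U)) ! (j - 1)"

end

(* Vectorising both tensor factors turns U into its 4 x 4 realignment R, and the Schmidt
   coefficients l_j are the singular values of R. With the spin flip
   S(A) = (Y \<otimes> Y) A (Y \<otimes> Y) and W = S(U^T) U, the cubic identity
     2 S(realign(cof R)) - S(cof U) = U (W - tr W / 2)
   holds for every U. When U is unitary, so is W, cof U = det U * conj U, and both cof U and
   U (W - tr W / 2) have Frobenius norm 2. Expanding the norm of the left-hand side gives
   |cof R|^2 = Re (conj (det U) * 4 det R) <= 4 |det R|.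
   In terms of p_j = l_j^2 / 4 this says e3(p)^2 <= e4(p) for the elementary symmetric
   polynomials, and since e1(p) = 1,
     (p1 p2 - p3 p4) (p1 p3 - p2 p4) (p1 p4 - p2 p3) = e1^2 e4 - e3^2 >= 0;
   for ordered p the first two factors are positive as soon as p1 p4 < p2 p3. *)

theory Submission
  imports Defs "HOL-Computational_Algebra.Polynomial"
begin

section \<open>Singular value decomposition\<close>

definition hinner :: "complex^'n \<Rightarrow> complex^'n \<Rightarrow> complex" where
  "hinner x y = (\<Sum>i\<in>UNIV. cnj (x $ i) * y $ i)"

lemma hinner_add_right: "hinner z (x + y) = hinner z x + hinner z y"
  and hinner_scale_left: "hinner (c *s x) z = cnj c * hinner x z"
  and hinner_scale_right: "hinner z (c *s x) = c * hinner z x"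
  and hinner_zero_right: "hinner z 0 = 0"
  by (simp_all add: hinner_def algebra_simps sum.distrib sum_distrib_left)

lemma hinner_commute: "hinner y x = cnj (hinner x y)"
  by (simp add: hinner_def mult.commute)

lemma inner_eq_hinner: "x \<bullet> y = Re (hinner x y)"
  by (simp add: hinner_def inner_vec_def inner_complex_def)

lemma hinner_self: "hinner x x = of_real ((norm x)\<^sup>2)"
proof -
  have "Im (hinner x x) = 0"
    by (simp add: hinner_def)
  then show ?thesis
    by (simp add: complex_eq_iff power2_norm_eq_inner inner_eq_hinner)
qed

text \<open>\<open>\<bullet>\<close> sees only the real part of \<open>hinner\<close>; multiplying
  one argument by the imaginary unit exposes the other part. Complex orthogonality thus becomes two
  real conditions, open to real dimension counts.\<close>

lemma hinner_eq_zero_iff: "hinner x y = 0 \<longleftrightarrow> x \<bullet> y = 0 \<and> (\<i> *s x) \<bullet> y = 0"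
  by (auto simp: inner_eq_hinner hinner_scale_left complex_eq_iff)

lemma hinner_norm_one: "norm x = 1 \<Longrightarrow> hinner x x = 1"
  by (simp add: hinner_self)

text \<open>The conditions amount to orthogonality to at most \<open>2 * card F\<close> real
  vectors, fewer than the real dimension \<open>2 * CARD('n)\<close>, so a nonzero solution exists
  and can be normalised.\<close>

lemma exists_hinner_orthogonal:
  fixes v :: "'k \<Rightarrow> complex^'n"
  assumes "finite F" "card F < CARD('n)"
  shows "\<exists>w. norm w = 1 \<and> (\<forall>j\<in>F. hinner (v j) w = 0)"
proof -
  let ?S = "v ` F \<union> (\<lambda>j. \<i> *s v j) ` F"
  have "dim ?S \<le> card ?S"
    using assms by (intro dim_le_card') auto
  also have "\<dots> \<le> card F + card F"
    by (meson add_mono assms(1) card_Un_le card_image_le order_trans)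
  also have "\<dots> < DIM(complex^'n)"
    using assms by simp
  finally obtain x :: "complex^'n" where x: "x \<noteq> 0" "\<And>y. y \<in> span ?S \<Longrightarrow> orthogonal x y"
    using orthogonal_to_subspace_exists by blast
  define w where "w = (1 / norm x) *\<^sub>R x"
  have "hinner (v j) w = 0" if "j \<in> F" for j
  proof -
    have "orthogonal x (v j)" "orthogonal x (\<i> *s v j)"
      using that by (auto intro!: x span_base)
    then show ?thesis
      by (simp add: hinner_eq_zero_iff w_def orthogonal_def inner_commute)
  qed
  moreover have "norm w = 1"
    using x by (simp add: w_def)
  ultimately show ?thesis by blast
qed

definition orthonormal_on :: "'k set \<Rightarrow> ('k \<Rightarrow> complex^'n) \<Rightarrow> bool" where
  "orthonormal_on F v \<longleftrightarrow> (\<forall>j\<in>F. \<forall>k\<in>F. hinner (v j) (v k) = (if j = k then 1 else 0))"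

lemma orthonormal_on_insert:
  assumes "orthonormal_on F v" "i \<notin> F" "norm w = 1" "\<And>j. j \<in> F \<Longrightarrow> hinner (v j) w = 0"
  shows "orthonormal_on (insert i F) (v(i := w))"
proof -
  have "hinner w (v j) = 0" if "j \<in> F" for j
    using assms(4)[OF that] hinner_commute[of w "v j"] by simp
  then show ?thesis
    using assms by (auto simp: orthonormal_on_def hinner_norm_one)
qed

text \<open>Indices are adjoined one at a time: while one is missing, the family is too small to
  exhaust the space. This later supplies singular vectors for the zero singular values.\<close>

lemma orthonormal_on_extend:
  fixes v :: "'n::finite \<Rightarrow> complex^'n"
  assumes "orthonormal_on F v"
  shows "\<exists>u. orthonormal_on UNIV u \<and> (\<forall>j\<in>F. u j = v j)"
proof -
  have "\<exists>u. orthonormal_on (F \<union> G) u \<and> (\<forall>j\<in>F. u j = v j)" for G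
    using finite[of G]
  proof (induction G)
    case empty
    then show ?case using assms by auto
  next
    case (insert i G)
    then obtain u where u: "orthonormal_on (F \<union> G) u" "\<forall>j\<in>F. u j = v j" by auto
    show ?case
    proof (cases "i \<in> F \<union> G")
      case True
      then show ?thesis using u by (intro exI[of _ u]) (simp add: insert_absorb)
    next
      case False
      then have "card (F \<union> G) < CARD('n)"
        by (intro psubset_card_mono) auto
      then obtain w where "norm w = 1" "\<forall>j\<in>F \<union> G. hinner (u j) w = 0"
        using exists_hinner_orthogonal[of "F \<union> G" u] by auto
      then have "orthonormal_on (F \<union> insert i G) (u(i := w))"
        using orthonormal_on_insert[OF u(1) False] by auto
      moreover have "\<forall>j\<in>F. (u(i := w)) j = v j" using u False by auto
      ultimately show ?thesis by blast
    qed
  qed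
  from this[of UNIV] show ?thesis by simp
qed

section \<open>Orthonormal bases with orthogonal images\<close>

lemma mult_vec_scale: "(A :: complex^'n^'m) *v (c *s x) = c *s (A *v x)"
  by (simp add: vector_scalar_commute)

lemma mult_vec_scaleR: "(A :: complex^'n^'m) *v (t *\<^sub>R x) = t *\<^sub>R (A *v x)"
  by (simp add: matrix_vector_mult_def vec_eq_iff scaleR_sum_right)

lemma linear_coeff_eq_zero:
  fixes a c :: real
  assumes "\<And>t. 2 * t * a \<le> t\<^sup>2 * c"
  shows "a = 0"
proof (rule ccontr)
  assume "a \<noteq> 0"
  \<comment> \<open>A positive upper bound for \<open>c\<close>; at \<open>t = a / d\<close> the
    linear term then beats the quadratic one.\<close>
  define d where "d = \<bar>c\<bar> + 1"
  have d: "d > 0" "c \<le> d" by (auto simp: d_def)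
  have "2 * (a / d) * a \<le> (a / d)\<^sup>2 * c" by (rule assms)
  also have "\<dots> \<le> (a / d)\<^sup>2 * d" by (intro mult_left_mono d) simp
  also have "\<dots> = (a / d) * a" using d by (simp add: power2_eq_square)
  finally have "a * a \<le> 0" using d by (simp add: field_simps)
  then show False using \<open>a \<noteq> 0\<close> not_real_square_gt_zero[of a] by simp
qed

text \<open>First-order optimality: comparing \<open>v\<close> with \<open>v + t *\<^sub>R x\<close>
  for real \<open>t\<close> of either sign forces the term linear in \<open>t\<close> to vanish.
  Taking \<open>w\<close> for \<open>x\<close> gives the real part of the claim; closure of
  \<open>S\<close> under the imaginary unit gives the imaginary part.\<close>

lemma hinner_image_maximizer:
  fixes A :: "complex^'n^'m"
  assumes S: "subspace S" "\<And>w. w \<in> S \<Longrightarrow> \<i> *s w \<in> S"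
    and v: "v \<in> S" "norm v = 1"
    and max: "\<And>w. w \<in> S \<Longrightarrow> norm w = 1 \<Longrightarrow> norm (A *v w) \<le> norm (A *v v)"
    and w: "w \<in> S" "hinner v w = 0"
  shows "hinner (A *v v) (A *v w) = 0"
proof -
  let ?m = "norm (A *v v)"
  \<comment> \<open>Homogeneity carries the maximality of \<open>v\<close> from the unit sphere to
    all of \<open>S\<close>.\<close>
  have bound: "(norm (A *v x))\<^sup>2 \<le> ?m\<^sup>2 * (norm x)\<^sup>2" if "x \<in> S" for x
  proof (cases "x = 0")
    case False
    have "norm (A *v ((1 / norm x) *\<^sub>R x)) \<le> ?m"
      using that False S by (intro max) (auto simp: subspace_scale)
    then have "norm (A *v x) \<le> ?m * norm x"
      using False by (simp add: mult_vec_scaleR field_simps)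
    then have "(norm (A *v x))\<^sup>2 \<le> (?m * norm x)\<^sup>2"
      by (intro power_mono) auto
    then show ?thesis by (simp add: power_mult_distrib)
  qed simp
  have orth: "(A *v v) \<bullet> (A *v x) = 0" if x: "x \<in> S" "hinner v x = 0" for x
  proof (rule linear_coeff_eq_zero)
    fix t :: real
    have "(norm (A *v (v + t *\<^sub>R x)))\<^sup>2 \<le> ?m\<^sup>2 * (norm (v + t *\<^sub>R x))\<^sup>2"
      using x v S by (intro bound) (auto simp: subspace_add subspace_scale)
    moreover have "v \<bullet> x = 0" using x by (simp add: inner_eq_hinner)
    then have "(norm (v + t *\<^sub>R x))\<^sup>2 = 1 + t\<^sup>2 * (norm x)\<^sup>2"
      using v by (simp add: power2_norm_eq_inner[symmetric] norm_add_Pythagorean orthogonal_def power_mult_distrib)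
    moreover have "(norm (A *v (v + t *\<^sub>R x)))\<^sup>2
        = ?m\<^sup>2 + 2 * t * ((A *v v) \<bullet> (A *v x)) + t\<^sup>2 * (norm (A *v x))\<^sup>2"
      unfolding power2_norm_eq_inner
      by (simp add: matrix_vector_right_distrib mult_vec_scaleR inner_add_left
          inner_add_right inner_commute power2_eq_square algebra_simps)
    ultimately have "2 * t * ((A *v v) \<bullet> (A *v x))
        \<le> t\<^sup>2 * (?m\<^sup>2 * (norm x)\<^sup>2 - (norm (A *v x))\<^sup>2)"
      by (simp add: algebra_simps)
    then show "2 * t * ((A *v v) \<bullet> (A *v x)) \<le> t\<^sup>2 * (?m\<^sup>2 * (norm x)\<^sup>2 - (norm (A *v x))\<^sup>2)" .
  qed
  have "(A *v v) \<bullet> (A *v w) = 0" by (rule orth[OF w])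
  moreover have "(A *v v) \<bullet> (A *v (\<i> *s w)) = 0"
    using w by (intro orth S) (simp_all add: hinner_scale_right)
  ultimately show ?thesis
    by (simp add: inner_eq_hinner mult_vec_scale hinner_scale_right complex_eq_iff)
qed

text \<open>Each new vector maximises the norm of its image on the unit sphere of the orthogonal
  complement of the previous ones.\<close>
lemma exists_right_singular_vectors:
  fixes A :: "complex^'n^'m"
  shows "\<exists>v :: 'n \<Rightarrow> complex^'n. orthonormal_on UNIV v \<and>
    (\<forall>j k. j \<noteq> k \<longrightarrow> hinner (A *v v j) (A *v v k) = 0)"
proof -
  \<comment> \<open>The third conjunct strengthens the induction: a vector chosen later is
    orthogonal to the family, so its image is orthogonal to the earlier images.\<close>
  have "\<exists>v :: 'n \<Rightarrow> complex^'n. orthonormal_on F v \<and>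
    (\<forall>j\<in>F. \<forall>k\<in>F. j \<noteq> k \<longrightarrow> hinner (A *v v j) (A *v v k) = 0) \<and>
    (\<forall>j\<in>F. \<forall>w. (\<forall>k\<in>F. hinner (v k) w = 0) \<longrightarrow> hinner (A *v v j) (A *v w) = 0)"
    (is "\<exists>v. ?P F v") for F
    using finite[of F]
  proof (induction F)
    case empty
    then show ?case by (simp add: orthonormal_on_def)
  next
    case (insert i F)
    obtain v :: "'n \<Rightarrow> complex^'n" where *: "?P F v"
      using insert.IH by (elim exE)
    note v = *[THEN conjunct1]
      and vv = *[THEN conjunct2, THEN conjunct1, rule_format]
      and vw = *[THEN conjunct2, THEN conjunct2, rule_format]
    define S where "S = {w. \<forall>k\<in>F. hinner (v k) w = 0}"
    have S: "subspace S"
      by (auto simp: subspace_def S_def hinner_add_right hinner_zero_right hinner_eq_zero_iff inner_add_right)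
    have Si: "\<i> *s w \<in> S" if "w \<in> S" for w
      using that by (simp add: S_def hinner_scale_right)
    have "card F < CARD('n)"
      using insert by (intro psubset_card_mono) auto
    then obtain w0 where "norm w0 = 1" "w0 \<in> S"
      using exists_hinner_orthogonal[of F v] insert by (auto simp: S_def)
    then have "S \<inter> sphere 0 1 \<noteq> {}" by auto
    moreover have "compact (S \<inter> sphere 0 1)"
      using S by (intro closed_Int_compact closed_subspace) auto
    moreover have "continuous_on (S \<inter> sphere 0 1) (\<lambda>w. norm (A *v w))"
      by (intro continuous_intros)
    ultimately obtain m where m: "m \<in> S \<inter> sphere 0 1"
      and max: "\<And>w. w \<in> S \<inter> sphere 0 1 \<Longrightarrow> norm (A *v w) \<le> norm (A *v m)"
      using continuous_attains_sup by metis
    have m1: "m \<in> S" "norm m = 1" using m by auto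
    have mw: "hinner (A *v m) (A *v w) = 0" if "w \<in> S" "hinner m w = 0" for w
      using S Si m1 max that by (intro hinner_image_maximizer[of S m]) auto
    have vm: "hinner (A *v v j) (A *v m) = 0" if "j \<in> F" for j
      using that m1 by (intro vw) (auto simp: S_def)
    then have mv: "hinner (A *v m) (A *v v j) = 0" if "j \<in> F" for j
      using that hinner_commute[of "A *v m"] by simp
    let ?v = "v(i := m)"
    have on: "orthonormal_on (insert i F) ?v"
      using insert v m1 by (intro orthonormal_on_insert) (auto simp: S_def)
    have oo: "\<forall>j\<in>insert i F. \<forall>k\<in>insert i F. j \<noteq> k \<longrightarrow> hinner (A *v ?v j) (A *v ?v k) = 0"
      using vv vm mv by auto
    have ow: "hinner (A *v ?v j) (A *v w) = 0"
      if "j \<in> insert i F" "\<forall>k\<in>insert i F. hinner (?v k) w = 0" for j w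
    proof -
      \<comment> \<open>Orthogonality to the enlarged family splits: membership in \<open>S\<close>
        serves the old vectors through \<open>vw\<close>, orthogonality to \<open>m\<close> serves
        the new one through \<open>mw\<close>.\<close>
      have "w \<in> S" "hinner m w = 0"
        using that insert by (auto simp: S_def split: if_splits)
      then show ?thesis using that vw mw by (auto simp: S_def)
    qed
    have "?P (insert i F) ?v"
      by (rule conjI, rule on, rule conjI, rule oo, intro ballI allI impI, rule ow)
    then show ?case by (rule exI[of _ ?v])
  qed
  from this[of UNIV] show ?thesis by auto
qed

section \<open>Adjoint, unitary and diagonal matrices\<close>

lemma cadjoint_nth [simp]: "cadjoint A $ i $ j = cnj (A $ j $ i)"
  by (simp add: cadjoint_def map_matrix_def transpose_def)

lemma cadjoint_cadjoint [simp]: "cadjoint (cadjoint A) = A"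
  by (simp add: vec_eq_iff)

lemma cadjoint_mult: "cadjoint (A ** B) = cadjoint B ** cadjoint A"
  by (simp add: vec_eq_iff matrix_matrix_mult_def mult.commute)

lemma unitary_cadjoint: "unitary U \<Longrightarrow> unitary (cadjoint U)"
  by (simp add: unitary_def)

lemma unitaryI: "cadjoint U ** U = mat 1 \<Longrightarrow> unitary U"
  by (simp add: unitary_def matrix_left_right_inverse)

lemma det_cadjoint: "det (cadjoint A) = cnj (det A)"
proof -
  have "det (map_matrix cnj B) = cnj (det B)" for B :: "complex^'n^'n"
    by (simp add: det_def map_matrix_def)
  from this[of "transpose A"] show ?thesis by (simp add: cadjoint_def)
qed

lemma cmod_det_unitary:
  assumes "unitary U" shows "cmod (det U) = 1"
proof -
  have "det (cadjoint U ** U) = 1" using assms by (simp add: unitary_def)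
  then have "cnj (det U) * det U = 1" by (simp add: det_mul det_cadjoint)
  then have "cmod (cnj (det U) * det U) = 1" by simp
  then have "(cmod (det U))\<^sup>2 = 1" by (simp add: norm_mult power2_eq_square)
  then show ?thesis by (simp add: power2_eq_1_iff) (use norm_ge_zero[of "det U"] in linarith)
qed

definition diag_mat :: "('n \<Rightarrow> 'a::zero) \<Rightarrow> 'a^'n^'n" where
  "diag_mat d = (\<chi> i j. if i = j then d i else 0)"

lemma mult_diag_mat_nth: "(A ** diag_mat d) $ i $ j = A $ i $ j * (d j :: 'a::semiring_1)"
  by (simp add: diag_mat_def matrix_matrix_mult_def if_distrib cong: if_cong)

lemma diag_mat_mult: "diag_mat c ** diag_mat d = diag_mat (\<lambda>i. c i * d i :: 'a::semiring_1)"
  by (simp add: vec_eq_iff mult_diag_mat_nth) (simp add: diag_mat_def)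

lemma det_diag_mat: "det (diag_mat d) = (\<Prod>i\<in>UNIV. d i)"
  by (subst det_diagonal) (simp_all add: diag_mat_def)

lemma cadjoint_mult_nth: "(cadjoint A ** B) $ i $ j = hinner (column i A) (column j B)"
  by (simp add: hinner_def matrix_matrix_mult_def column_def)

lemma unitary_columns_iff: "unitary U \<longleftrightarrow> orthonormal_on UNIV (\<lambda>j. column j U)"
proof -
  have "unitary U \<longleftrightarrow> cadjoint U ** U = mat 1"
    using unitaryI unitary_def by blast
  also have "\<dots> \<longleftrightarrow> orthonormal_on UNIV (\<lambda>j. column j U)"
    by (simp add: vec_eq_iff orthonormal_on_def cadjoint_mult_nth mat_def)
  finally show ?thesis .
qed

text \<open>The right singular vectors form \<open>X\<close>, and their normalised images form
  \<open>V\<close>, completed to an orthonormal basis. Then \<open>A ** X\<close> is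
  \<open>V\<close> with scaled columns, and \<open>cadjoint X\<close> undoes
  \<open>X\<close>.\<close>

theorem singular_value_decomposition:
  fixes A :: "complex^'n^'n"
  shows "\<exists>V W l. unitary V \<and> unitary W \<and> (\<forall>j. l j \<ge> 0) \<and>
    A = V ** diag_mat (\<lambda>j. of_real (l j)) ** W"
proof -
  obtain v :: "'n \<Rightarrow> complex^'n" where v: "orthonormal_on UNIV v"
    and Av: "\<And>j k. j \<noteq> k \<Longrightarrow> hinner (A *v v j) (A *v v k) = 0"
    using exists_right_singular_vectors[of A] by blast
  define l where "l j = norm (A *v v j)" for j
  \<comment> \<open>Where \<open>l j = 0\<close>, this is the zero vector, because
    \<open>1 / 0 = 0\<close>; the extension below puts a unit vector there, and both sides of the
    column equation vanish.\<close>
  define u0 where "u0 j = (of_real (1 / l j) :: complex) *s (A *v v j)" for j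
  have "hinner (u0 j) (u0 k) = (if j = k then 1 else 0)" if "l j \<noteq> 0" for j k
    using that by (auto simp: u0_def hinner_scale_left hinner_scale_right Av hinner_self
        l_def[symmetric] power2_eq_square)
  then have "orthonormal_on {j. l j \<noteq> 0} u0"
    by (simp add: orthonormal_on_def)
  then obtain u where u: "orthonormal_on UNIV u" "\<And>j. l j \<noteq> 0 \<Longrightarrow> u j = u0 j"
    using orthonormal_on_extend[of _ u0] by blast
  define V where "V = (\<chi> i j. u j $ i)"
  define X where "X = (\<chi> i j. v j $ i)"
  have cols: "column j V = u j" "column j X = v j" for j
    by (simp_all add: V_def X_def column_def vec_eq_iff)
  have V: "unitary V" and X: "unitary X"
    using u v by (simp_all add: unitary_columns_iff cols)
  have "A ** X = V ** diag_mat (\<lambda>j. of_real (l j))"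
  proof -
    have "(A *v v j) $ i = of_real (l j) * u j $ i" for i j
    proof (cases "l j = 0")
      case True
      then show ?thesis by (simp add: l_def)
    next
      case False
      then show ?thesis by (simp add: u u0_def)
    qed
    then show ?thesis
      by (simp add: vec_eq_iff mult_diag_mat_nth)
        (simp add: V_def X_def matrix_matrix_mult_def matrix_vector_mult_def mult.commute)
  qed
  then have "A ** X ** cadjoint X = V ** diag_mat (\<lambda>j. of_real (l j)) ** cadjoint X"
    by simp
  then have "A = V ** diag_mat (\<lambda>j. of_real (l j)) ** cadjoint X"
    using X by (simp add: matrix_mul_assoc[symmetric] unitary_def)
  moreover have "l j \<ge> 0" for j by (simp add: l_def)
  ultimately show ?thesis using V unitary_cadjoint[OF X] by blast
qed

section \<open>Uniqueness of singular values\<close>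

lemma cadjoint_diag_mat: "cadjoint (diag_mat d) = diag_mat (\<lambda>i. cnj (d i))"
  by (auto simp: vec_eq_iff diag_mat_def)

lemma mat_eq_diag_mat: "mat c = diag_mat (\<lambda>i. c)"
  by (simp add: mat_def diag_mat_def)

lemma matrix_mult_add_left: "(A + B) ** C = A ** C + B ** (C :: 'a::semiring_1^'k^'n)"
  by (simp add: vec_eq_iff matrix_matrix_mult_def algebra_simps sum.distrib)

text \<open>The right factor \<open>W\<close> cancels in \<open>A ** cadjoint A\<close>, and scalar
  matrices commute with \<open>V\<close>, so the whole sum is diagonalised by \<open>V\<close>. The
  left-hand side depends on \<open>A\<close> alone, not on the chosen decomposition.\<close>

lemma det_singular_values:
  fixes V W :: "complex^'n^'n"
  assumes "unitary V" "unitary W" "A = V ** diag_mat (\<lambda>j. of_real (l j)) ** W"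
  shows "det (mat (of_real x) + A ** cadjoint A) = of_real (\<Prod>j\<in>UNIV. (l j)\<^sup>2 + x)"
proof -
  let ?D = "diag_mat (\<lambda>j. of_real (l j)) :: complex^'n^'n"
  have "A ** cadjoint A = V ** (?D ** (W ** cadjoint W) ** cadjoint ?D) ** cadjoint V"
    by (simp add: assms(3) cadjoint_mult matrix_mul_assoc)
  also have "W ** cadjoint W = mat 1" using assms by (simp add: unitary_def)
  finally have "A ** cadjoint A = V ** diag_mat (\<lambda>j. of_real ((l j)\<^sup>2)) ** cadjoint V"
    by (simp add: cadjoint_diag_mat diag_mat_mult power2_eq_square)
  moreover have "mat (of_real x) = V ** diag_mat (\<lambda>j. of_real x) ** cadjoint V"
  proof -
    have "V ** mat (of_real x) = mat (of_real x) ** V"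
      by (simp add: vec_eq_iff matrix_matrix_mult_def mat_def if_distrib if_distribR mult.commute cong: if_cong)
    then show ?thesis
      using assms by (simp add: mat_eq_diag_mat[symmetric] matrix_mul_assoc[symmetric] unitary_def)
  qed
  moreover have "diag_mat c + diag_mat d = diag_mat (\<lambda>i. c i + d i)" for c d :: "'n \<Rightarrow> complex"
    by (simp add: vec_eq_iff diag_mat_def)
  ultimately have "mat (of_real x) + A ** cadjoint A
      = V ** diag_mat (\<lambda>j. of_real ((l j)\<^sup>2 + x)) ** cadjoint V"
    by (simp add: matrix_add_ldistrib[symmetric] matrix_mult_add_left[symmetric] add.commute)
  then have "det (mat (of_real x) + A ** cadjoint A)
      = (det V * det (cadjoint V)) * of_real (\<Prod>j\<in>UNIV. (l j)\<^sup>2 + x)"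
    by (simp add: det_mul det_diag_mat)
  also have "det V * det (cadjoint V) = det (V ** cadjoint V)" by (simp add: det_mul)
  also have "\<dots> = 1" using assms by (simp add: unitary_def)
  finally show ?thesis by simp
qed

text \<open>The determinant fixes the values of the polynomial with roots
  \<open>- (l j)\<^sup>2\<close> at all real points, hence the polynomial and its multiset of
  roots.\<close>

lemma singular_values_unique:
  fixes V W V' W' :: "complex^'n^'n" and l m :: "'n \<Rightarrow> real"
  assumes "unitary V" "unitary W" "unitary V'" "unitary W'"
    and "V ** diag_mat (\<lambda>j. of_real (l j)) ** W = V' ** diag_mat (\<lambda>j. of_real (m j)) ** W'"
  shows "image_mset (\<lambda>j. (l j)\<^sup>2) (mset_set UNIV) = image_mset (\<lambda>j. (m j)\<^sup>2) (mset_set UNIV)"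
proof -
  define p where "p l = (\<Prod>j\<in>UNIV. [:(l j)\<^sup>2, 1:])" for l :: "'n \<Rightarrow> real"
  have proots: "proots (p l) = image_mset (\<lambda>j. - (l j)\<^sup>2) (mset_set UNIV)" for l
    unfolding p_def by (subst proots_prod) (auto simp: sum_unfold_sum_mset multiset.map_comp o_def)
  have "poly (p l) x = poly (p m) x" for x
  proof -
    have "complex_of_real (poly (p l) x) = of_real (poly (p m) x)"
      using det_singular_values[OF assms(1,2) refl, of x l]
        det_singular_values[OF assms(3,4) assms(5), of x]
      by (simp add: p_def poly_prod)
    then show ?thesis using of_real_eq_iff by blast
  qed
  then have "p l = p m" by (intro poly_ext) auto
  then have "image_mset uminus (proots (p l)) = image_mset uminus (proots (p m))" by simp
  then show ?thesis by (simp add: proots multiset.map_comp o_def)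
qed

section \<open>The cofactor matrix\<close>

text \<open>Putting a unit vector into column \<open>j\<close> absorbs the usual sign of the
  cofactor, so the index type needs no numbering. This is the transpose of the adjugate.\<close>

definition cofactor_mat :: "'a::comm_ring_1^'n^'n \<Rightarrow> 'a^'n^'n" where
  "cofactor_mat A = (\<chi> i j. det (\<chi> k l. if l = j then (if k = i then 1 else 0) else A $ k $ l))"

text \<open>Rows are indexed by the entries of the first tensor factor and columns by those of the
  second, so \<open>kron A B\<close> becomes a matrix of rank at most one. The map is an
  involution.\<close>

definition realign :: "'a^('n::finite \<times> 'n)^('n \<times> 'n) \<Rightarrow> 'a^('n \<times> 'n)^('n \<times> 'n)" where
  "realign U = (\<chi> a b. U $ (fst a, fst b) $ (snd a, snd b))"

definition flip_index :: "2 \<times> 2 \<Rightarrow> 2 \<times> 2" where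
  "flip_index a = (if fst a = 1 then 2 else 1, if snd a = 1 then 2 else 1)"

text \<open>Up to a common factor -1, which cancels in \<open>spin_flip\<close>, these are the
  nonzero entries of Y \<otimes> Y.\<close>

definition flip_sign :: "2 \<times> 2 \<Rightarrow> 'a::comm_ring_1" where
  "flip_sign a = (if fst a = snd a then 1 else - 1)"

definition spin_flip :: "'a::comm_ring_1^(2 \<times> 2)^(2 \<times> 2) \<Rightarrow> 'a^(2 \<times> 2)^(2 \<times> 2)" where
  "spin_flip A = (\<chi> a b. flip_sign a * flip_sign b * A $ flip_index a $ flip_index b)"

section \<open>Explicit expansions over four indices and the cubic identity\<close>

lemma UNIV_2x2: "(UNIV :: (2 \<times> 2) set) = {(1,1), (1,2), (2,1), (2,2)}"
  unfolding UNIV_Times_UNIV[symmetric] UNIV_2 by auto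

lemma forall_2x2: "(\<forall>a :: 2 \<times> 2. P a) \<longleftrightarrow> P (1,1) \<and> P (1,2) \<and> P (2,1) \<and> P (2,2)"
  by (simp add: forall_2 split_paired_All)

lemma sum_2x2: "(\<Sum>a\<in>(UNIV :: (2 \<times> 2) set). f a) = f (1,1) + f (1,2) + f (2,1) + f (2,2)"
  by (simp add: UNIV_2x2 add.assoc)

text \<open>The Leibniz formula with permutations enumerated by inserting one index at a time.
  Written out, it makes the later determinant identities plain polynomial identities.\<close>

lemma det_2x2:
  fixes A :: "'a::comm_ring_1^(2 \<times> 2)^(2 \<times> 2)"
  shows "det A = A $ (1,1) $ (1,1) * A $ (1,2) $ (1,2) * A $ (2,1) $ (2,1) * A $ (2,2) $ (2,2)
    + A $ (1,1) $ (1,1) * A $ (1,2) $ (2,1) * A $ (2,1) $ (2,2) * A $ (2,2) $ (1,2)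
    + A $ (1,1) $ (1,1) * A $ (1,2) $ (2,2) * A $ (2,1) $ (1,2) * A $ (2,2) $ (2,1)
    + A $ (1,1) $ (1,2) * A $ (1,2) $ (1,1) * A $ (2,1) $ (2,2) * A $ (2,2) $ (2,1)
    + A $ (1,1) $ (1,2) * A $ (1,2) $ (2,1) * A $ (2,1) $ (1,1) * A $ (2,2) $ (2,2)
    + A $ (1,1) $ (1,2) * A $ (1,2) $ (2,2) * A $ (2,1) $ (2,1) * A $ (2,2) $ (1,1)
    + A $ (1,1) $ (2,1) * A $ (1,2) $ (1,1) * A $ (2,1) $ (1,2) * A $ (2,2) $ (2,2)
    + A $ (1,1) $ (2,1) * A $ (1,2) $ (1,2) * A $ (2,1) $ (2,2) * A $ (2,2) $ (1,1)
    + A $ (1,1) $ (2,1) * A $ (1,2) $ (2,2) * A $ (2,1) $ (1,1) * A $ (2,2) $ (1,2)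
    + A $ (1,1) $ (2,2) * A $ (1,2) $ (1,1) * A $ (2,1) $ (2,1) * A $ (2,2) $ (1,2)
    + A $ (1,1) $ (2,2) * A $ (1,2) $ (1,2) * A $ (2,1) $ (1,1) * A $ (2,2) $ (2,1)
    + A $ (1,1) $ (2,2) * A $ (1,2) $ (2,1) * A $ (2,1) $ (1,2) * A $ (2,2) $ (1,1)
    - A $ (1,1) $ (1,1) * A $ (1,2) $ (1,2) * A $ (2,1) $ (2,2) * A $ (2,2) $ (2,1)
    - A $ (1,1) $ (1,1) * A $ (1,2) $ (2,1) * A $ (2,1) $ (1,2) * A $ (2,2) $ (2,2)
    - A $ (1,1) $ (1,1) * A $ (1,2) $ (2,2) * A $ (2,1) $ (2,1) * A $ (2,2) $ (1,2)
    - A $ (1,1) $ (1,2) * A $ (1,2) $ (1,1) * A $ (2,1) $ (2,1) * A $ (2,2) $ (2,2)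
    - A $ (1,1) $ (1,2) * A $ (1,2) $ (2,1) * A $ (2,1) $ (2,2) * A $ (2,2) $ (1,1)
    - A $ (1,1) $ (1,2) * A $ (1,2) $ (2,2) * A $ (2,1) $ (1,1) * A $ (2,2) $ (2,1)
    - A $ (1,1) $ (2,1) * A $ (1,2) $ (1,1) * A $ (2,1) $ (2,2) * A $ (2,2) $ (1,2)
    - A $ (1,1) $ (2,1) * A $ (1,2) $ (1,2) * A $ (2,1) $ (1,1) * A $ (2,2) $ (2,2)
    - A $ (1,1) $ (2,1) * A $ (1,2) $ (2,2) * A $ (2,1) $ (1,2) * A $ (2,2) $ (1,1)
    - A $ (1,1) $ (2,2) * A $ (1,2) $ (1,1) * A $ (2,1) $ (1,2) * A $ (2,2) $ (2,1)
    - A $ (1,1) $ (2,2) * A $ (1,2) $ (1,2) * A $ (2,1) $ (2,1) * A $ (2,2) $ (1,1)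
    - A $ (1,1) $ (2,2) * A $ (1,2) $ (2,1) * A $ (2,1) $ (1,1) * A $ (2,2) $ (1,2)"
proof -
  have f: "finite {(1::2,2::2), (2::2,1::2), (2::2,2::2)}" "(1::2,1::2) \<notin> {(1,2), (2,1), (2,2)}"
    "finite {(2::2,1::2), (2::2,2::2)}" "(1::2,2::2) \<notin> {(2,1), (2,2)}"
    "finite {(2::2,2::2)}" "(2::2,1::2) \<notin> {(2,2)}"
    by auto
  show ?thesis
    unfolding det_def UNIV_2x2
    unfolding sum_over_permutations_insert[OF f(1,2)]
    unfolding sum_over_permutations_insert[OF f(3,4)]
    unfolding sum_over_permutations_insert[OF f(5,6)]
    unfolding permutes_sing
    by (simp add: sign_swap_id permutation_swap_id permutation_compose sign_compose sign_id swap_id_eq)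
qed

text \<open>All terms are cubic forms in the sixteen entries of \<open>U\<close>, so the identity
  can be verified entry by entry with commutative ring arithmetic.\<close>

lemma cofactor_realign_identity:
  fixes U :: "complex^(2 \<times> 2)^(2 \<times> 2)"
  defines "W \<equiv> spin_flip (transpose U) ** U"
  shows "2 *\<^sub>R spin_flip (realign (cofactor_mat (realign U))) - spin_flip (cofactor_mat U)
    = U ** (W - mat (trace W / 2))"
proof -
  have trace_W: "trace W = (\<Sum>a\<in>UNIV. \<Sum>b\<in>UNIV. spin_flip (transpose U) $ a $ b * U $ b $ a)"
    by (simp add: W_def trace_def matrix_matrix_mult_def)
  have "(2 *\<^sub>R spin_flip (realign (cofactor_mat (realign U))) - spin_flip (cofactor_mat U)) $ a $ b
    = (\<Sum>c\<in>UNIV. \<Sum>d\<in>UNIV. U $ a $ c * spin_flip (transpose U) $ c $ d * U $ d $ b) - U $ a $ b * trace W / 2"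
    for a b
  proof -
    \<comment> \<open>The entrywise claim times 2, which leaves no division for
      \<open>algebra\<close>; the quantifiers let \<open>forall_2x2\<close> split it into sixteen
      equations.\<close>
    have "\<forall>a b. 4 * spin_flip (realign (cofactor_mat (realign U))) $ a $ b
      = 2 * spin_flip (cofactor_mat U) $ a $ b +
      2 * (\<Sum>c\<in>UNIV. \<Sum>d\<in>UNIV. U $ a $ c * spin_flip (transpose U) $ c $ d * U $ d $ b) - U $ a $ b * trace W"
      unfolding forall_2x2 trace_W
      by (intro conjI; simp add: realign_def spin_flip_def cofactor_mat_def det_2x2 sum_2x2
            transpose_def flip_index_def flip_sign_def; algebra)
    then have "4 * spin_flip (realign (cofactor_mat (realign U))) $ a $ b
      = 2 * spin_flip (cofactor_mat U) $ a $ b +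
      2 * (\<Sum>c\<in>UNIV. \<Sum>d\<in>UNIV. U $ a $ c * spin_flip (transpose U) $ c $ d * U $ d $ b) - U $ a $ b * trace W"
      by blast
    then show ?thesis by (simp add: scaleR_conv_of_real field_simps)
  qed
  moreover have "(U ** (W - mat t)) $ a $ b
    = (\<Sum>c\<in>UNIV. \<Sum>d\<in>UNIV. U $ a $ c * spin_flip (transpose U) $ c $ d * U $ d $ b) - U $ a $ b * t" for a b t
  proof -
    have "(U ** (W - mat t)) $ a $ b = (\<Sum>c\<in>UNIV. U $ a $ c * W $ c $ b) - (\<Sum>c\<in>UNIV. U $ a $ c * mat t $ c $ b)"
      by (simp add: matrix_matrix_mult_def algebra_simps sum_subtractf)
    also have "(\<Sum>c\<in>UNIV. U $ a $ c * mat t $ c $ b) = U $ a $ b * t"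
      by (simp add: mat_def if_distrib cong: if_cong)
    finally show ?thesis
      by (simp add: W_def matrix_matrix_mult_def sum_distrib_left mult.assoc)
  qed
  ultimately show ?thesis by (simp add: vec_eq_iff)
qed

section \<open>Frobenius norm and unitary invariance\<close>

lemma norm_mat_sq: "(norm (A :: complex^'n^'m))\<^sup>2 = (\<Sum>i\<in>UNIV. \<Sum>j\<in>UNIV. (cmod (A $ i $ j))\<^sup>2)"
  by (simp add: norm_vec_def L2_set_def sum_nonneg)

lemma norm_mat_sq_trace: "of_real ((norm A)\<^sup>2) = trace (cadjoint A ** (A :: complex^'n^'m))"
proof -
  have "of_real ((norm A)\<^sup>2) = (\<Sum>i\<in>UNIV. \<Sum>j\<in>UNIV. cnj (A $ i $ j) * A $ i $ j)"
    by (simp add: norm_mat_sq complex_norm_square mult.commute del: of_real_power)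
  also have "\<dots> = trace (cadjoint A ** A)"
    unfolding trace_def matrix_matrix_mult_def by (subst sum.swap) simp
  finally show ?thesis .
qed

lemma norm_cadjoint: "norm (cadjoint A) = norm (A :: complex^'n^'m)"
proof -
  have "(norm (cadjoint A))\<^sup>2 = (norm A)\<^sup>2"
    unfolding norm_mat_sq by (subst sum.swap) simp
  then show ?thesis by simp
qed

lemma norm_unitary_mult:
  assumes "unitary U" shows "norm (U ** A) = norm A"
proof -
  have "cadjoint (U ** A) ** (U ** A) = cadjoint A ** (cadjoint U ** U) ** A"
    by (simp add: cadjoint_mult matrix_mul_assoc)
  also have "\<dots> = cadjoint A ** A" using assms by (simp add: unitary_def)
  finally have "complex_of_real ((norm (U ** A))\<^sup>2) = of_real ((norm A)\<^sup>2)"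
    by (simp only: norm_mat_sq_trace)
  then show ?thesis by (simp only: of_real_eq_iff) simp
qed

lemma norm_mult_unitary:
  assumes "unitary U" shows "norm (A ** U) = norm A"
  using norm_unitary_mult[OF unitary_cadjoint[OF assms], of "cadjoint A"]
  by (simp add: cadjoint_mult[symmetric] norm_cadjoint)

lemma norm_unitary: "unitary (U :: complex^'n^'n) \<Longrightarrow> (norm U)\<^sup>2 = real CARD('n)"
  using norm_mat_sq_trace[of U]
  by (simp add: unitary_def trace_def mat_def del: of_real_power)
   (metis of_real_eq_iff of_real_of_nat_eq)

lemma norm_diag_mat: "(norm (diag_mat d :: complex^'n^'n))\<^sup>2 = (\<Sum>i\<in>UNIV. (cmod (d i))\<^sup>2)"
proof -
  have "(norm (diag_mat d :: complex^'n^'n))\<^sup>2 = (\<Sum>i\<in>UNIV. \<Sum>j\<in>UNIV. if j = i then (cmod (d i))\<^sup>2 else 0)"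
    unfolding norm_mat_sq by (intro sum.cong refl) (simp add: diag_mat_def)
  then show ?thesis by simp
qed

section \<open>Norm of the cofactor matrix\<close>

text \<open>Cramer's rule: column \<open>i\<close> of \<open>B\<close> solves the system whose
  right-hand side is the \<open>i\<close>-th unit vector, and the cofactor is the numerator for its
  \<open>j\<close>-th component.\<close>

lemma cofactor_mat_right_inverse:
  fixes A :: "'a::field^'n^'n"
  assumes "A ** B = mat 1"
  shows "cofactor_mat A $ i $ j = det A * B $ j $ i"
proof -
  have "(A *v column i B) $ k = (if k = i then 1 else 0)" for k
  proof -
    have "(A *v column i B) $ k = (A ** B) $ k $ i"
      by (simp add: matrix_vector_mult_def matrix_matrix_mult_def column_def)
    then show ?thesis by (simp add: assms mat_def)
  qed
  then show ?thesis
    using cramer_lemma[of j A "column i B"] by (simp add: cofactor_mat_def column_def mult.commute cong: if_cong)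
qed

lemma norm_cofactor_mat_right_inverse:
  fixes A :: "complex^'n^'n"
  assumes "A ** B = mat 1"
  shows "(norm (cofactor_mat A))\<^sup>2 = (cmod (det A))\<^sup>2 * (norm B)\<^sup>2"
proof -
  have "(norm (cofactor_mat A))\<^sup>2 = (\<Sum>i\<in>UNIV. \<Sum>j\<in>UNIV. (cmod (det A))\<^sup>2 * (cmod (B $ j $ i))\<^sup>2)"
    by (simp add: norm_mat_sq cofactor_mat_right_inverse[OF assms] norm_mult power_mult_distrib)
  also have "\<dots> = (cmod (det A))\<^sup>2 * (norm B)\<^sup>2"
    unfolding norm_mat_sq sum_distrib_left by (rule sum.swap)
  finally show ?thesis .
qed

lemma cofactor_mat_unitary:
  "unitary U \<Longrightarrow> cofactor_mat U $ i $ j = det U * cnj (U $ i $ j)"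
  using cofactor_mat_right_inverse[of U "cadjoint U"] by (simp add: unitary_def)

text \<open>The entries are polynomials in \<open>t\<close>; this justifies the limit from
  invertible to singular matrices.\<close>

lemma continuous_norm_cofactor_mat:
  fixes A B :: "complex^'n^'n"
  shows "continuous_on UNIV (\<lambda>t :: real. norm (cofactor_mat (A + t *\<^sub>R B)))"
proof -
  have "continuous_on UNIV (\<lambda>t :: real. cofactor_mat (A + t *\<^sub>R B) $ i $ j)" for i j
  proof -
    have "continuous_on UNIV (\<lambda>t :: real. (if l = j then (if k = i then 1 else 0) else (A + t *\<^sub>R B) $ k $ l))" for k l
      by (cases "l = j") (auto intro!: continuous_intros)
    then show ?thesis
      unfolding cofactor_mat_def det_def by (simp only: vec_lambda_beta) (intro continuous_intros)
  qed
  then have "continuous_on UNIV (\<lambda>t :: real. \<chi> i j. cofactor_mat (A + t *\<^sub>R B) $ i $ j)"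
    by (intro continuous_on_vec_lambda)
  then show ?thesis by (simp add: continuous_on_norm)
qed

lemma norm_cofactor_mat_singular_values:
  fixes V W :: "complex^'n^'n"
  assumes V: "unitary V" and W: "unitary W" and l: "\<And>j. l j \<ge> 0"
    and A: "A = V ** diag_mat (\<lambda>j. of_real (l j)) ** W"
  shows "(norm (cofactor_mat A))\<^sup>2 = (\<Sum>j\<in>UNIV. \<Prod>k\<in>UNIV - {j}. (l k)\<^sup>2)"
proof -
  \<comment> \<open>Since \<open>A\<close> may be singular, its singular values are shifted by \<open>t > 0\<close>, and \<open>t\<close> tends to 0.\<close>
  define f where "f t = (norm (cofactor_mat (A + t *\<^sub>R (V ** W))))\<^sup>2" for t :: real
  define g where "g t = (\<Sum>j\<in>UNIV. \<Prod>k\<in>UNIV - {j}. (l k + t)\<^sup>2)" for t :: real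
  have "f t = g t" if t: "t > 0" for t
  proof -
    let ?D = "diag_mat (\<lambda>j. of_real (l j + t)) :: complex^'n^'n"
    let ?E = "diag_mat (\<lambda>j. of_real (1 / (l j + t))) :: complex^'n^'n"
    have pos: "l j + t > 0" for j using l[of j] t by linarith
    have "t *\<^sub>R V = V ** diag_mat (\<lambda>j. of_real t)"
      by (simp add: vec_eq_iff mult_diag_mat_nth scaleR_conv_of_real[where 'a = complex] mult.commute)
    moreover have "t *\<^sub>R (V ** W) = (t *\<^sub>R V) ** W"
      by (simp add: vec_eq_iff matrix_matrix_mult_def scaleR_sum_right)
    ultimately have "t *\<^sub>R (V ** W) = V ** diag_mat (\<lambda>j. of_real t) ** W"
      by simp
    moreover have "?D = diag_mat (\<lambda>j. of_real (l j)) + diag_mat (\<lambda>j. of_real t)"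
      by (simp add: vec_eq_iff diag_mat_def)
    ultimately have At: "A + t *\<^sub>R (V ** W) = V ** ?D ** W"
      by (simp add: A matrix_add_ldistrib matrix_mult_add_left)
    have DE: "?D ** ?E = mat 1"
      using pos by (simp add: diag_mat_mult mat_eq_diag_mat less_imp_neq[symmetric] del: of_real_add of_real_divide flip: of_real_mult)
    have "V ** ?D ** W ** (cadjoint W ** ?E ** cadjoint V)
      = V ** (?D ** ((W ** cadjoint W) ** ?E)) ** cadjoint V"
      by (simp add: matrix_mul_assoc)
    also have "\<dots> = mat 1"
      using V W DE by (simp add: unitary_def)
    finally have inv: "V ** ?D ** W ** (cadjoint W ** ?E ** cadjoint V) = mat 1" .
    have "cmod (det (V ** ?D ** W)) = (\<Prod>j\<in>UNIV. l j + t)"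
      using pos by (simp add: det_mul norm_mult cmod_det_unitary V W det_diag_mat abs_of_pos prod_norm[symmetric] del: of_real_add)
    moreover have "(norm (cadjoint W ** ?E ** cadjoint V))\<^sup>2 = (\<Sum>j\<in>UNIV. 1 / (l j + t)\<^sup>2)"
      by (simp add: norm_mult_unitary norm_unitary_mult unitary_cadjoint V W norm_diag_mat norm_divide power_divide del: of_real_add)
    \<comment> \<open>The cofactor norm is the modulus of the determinant times the norm of the
      inverse; each reciprocal square then deletes one factor from the product.\<close>
    ultimately have "f t = (\<Prod>j\<in>UNIV. l j + t)\<^sup>2 * (\<Sum>j\<in>UNIV. 1 / (l j + t)\<^sup>2)"
      using norm_cofactor_mat_right_inverse[OF inv] by (simp add: f_def At)
    also have "\<dots> = (\<Sum>j\<in>UNIV. (\<Prod>k\<in>UNIV. (l k + t)\<^sup>2) / (l j + t)\<^sup>2)"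
      by (simp add: sum_distrib_left prod_power_distrib)
    also have "\<dots> = g t"
      unfolding g_def
    proof (intro sum.cong refl)
      fix j
      have "l j + t \<noteq> 0" using pos[of j] by simp
      then show "(\<Prod>k\<in>UNIV. (l k + t)\<^sup>2) / (l j + t)\<^sup>2 = (\<Prod>k\<in>UNIV - {j}. (l k + t)\<^sup>2)"
        by (subst prod.remove[of UNIV j]) auto
    qed
    finally show ?thesis .
  qed
  then have "eventually (\<lambda>t. f t = g t) (at_right 0)"
    by (auto simp: eventually_at_right_less intro: eventually_mono[OF eventually_at_right_less])
  moreover have "(f \<longlongrightarrow> f 0) (at_right 0)"
  proof -
    have "continuous_on UNIV f"
      unfolding f_def by (intro continuous_intros continuous_norm_cofactor_mat)
    then show ?thesis
      by (auto simp: continuous_on_def intro: tendsto_within_subset)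
  qed
  moreover have "(g \<longlongrightarrow> g 0) (at_right 0)"
    unfolding g_def by (auto intro!: tendsto_eq_intros)
  ultimately have "f 0 = g 0"
    by (metis tendsto_cong tendsto_unique trivial_limit_at_right_real)
  then show ?thesis by (simp add: f_def g_def)
qed

section \<open>The determinant bound for realigned unitaries\<close>

lemma norm_spin_flip: "norm (spin_flip A) = norm (A :: complex^(2 \<times> 2)^(2 \<times> 2))"
proof -
  have "(norm (spin_flip A))\<^sup>2 = (norm A)\<^sup>2"
    by (simp add: norm_mat_sq sum_2x2 spin_flip_def flip_index_def flip_sign_def)
  then show ?thesis by simp
qed

lemma norm_realign: "norm (realign A) = norm (A :: complex^(2 \<times> 2)^(2 \<times> 2))"
proof -
  have "(norm (realign A))\<^sup>2 = (norm A)\<^sup>2"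
    by (simp add: norm_mat_sq sum_2x2 realign_def)
  then show ?thesis by simp
qed

text \<open>\<open>spin_flip\<close> is conjugation by the involution Y \<otimes> Y.\<close>

lemma spin_flip_mult: "spin_flip (A ** B) = spin_flip A ** spin_flip B"
  unfolding vec_eq_iff forall_2x2
  by (simp add: spin_flip_def flip_index_def flip_sign_def matrix_matrix_mult_def sum_2x2)

lemma unitary_spin_flip:
  assumes "unitary U" shows "unitary (spin_flip U)"
proof (rule unitaryI)
  have "cadjoint (spin_flip U) = spin_flip (cadjoint U)"
    by (simp add: vec_eq_iff spin_flip_def flip_sign_def)
  moreover have "spin_flip (mat 1) = mat 1"
    unfolding vec_eq_iff forall_2x2 by (simp add: spin_flip_def flip_index_def flip_sign_def mat_def)
  ultimately show "cadjoint (spin_flip U) ** spin_flip U = mat 1"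
    using assms by (simp add: spin_flip_mult[symmetric] unitary_def)
qed

lemma unitary_transpose:
  assumes "unitary U" shows "unitary (transpose U)"
proof (rule unitaryI)
  have "cadjoint (transpose U) ** transpose U = map_matrix cnj (U ** cadjoint U)"
    by (simp add: vec_eq_iff matrix_matrix_mult_def transpose_def map_matrix_def mult.commute)
  then show "cadjoint (transpose U) ** transpose U = mat 1"
    using assms by (simp add: unitary_def vec_eq_iff map_matrix_def mat_def)
qed

lemma unitary_mult: "unitary U \<Longrightarrow> unitary V \<Longrightarrow> unitary (U ** V)"
proof (rule unitaryI)
  assume U: "unitary U" and V: "unitary V"
  have "cadjoint (U ** V) ** (U ** V) = cadjoint V ** (cadjoint U ** U) ** V"
    by (simp add: cadjoint_mult matrix_mul_assoc)
  then show "cadjoint (U ** V) ** (U ** V) = mat 1"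
    using U V by (simp add: unitary_def)
qed

text \<open>The orthogonal projection of \<open>W\<close> onto the multiples of the identity is
  \<open>mat (trace W / 4)\<close>. Subtracting it twice is a reflection, which preserves the
  norm.\<close>

lemma norm_minus_half_trace:
  assumes "unitary (W :: complex^(2 \<times> 2)^(2 \<times> 2))"
  shows "(norm (W - mat (trace W / 2)))\<^sup>2 = 4"
proof -
  have inner: "W \<bullet> mat c = Re (cnj c * trace W)" for c
    by (simp add: inner_vec_def inner_complex_def mat_def trace_def sum_2x2 algebra_simps)
  have "(norm (W - mat (trace W / 2)))\<^sup>2 = (norm W)\<^sup>2 - 2 * (W \<bullet> mat (trace W / 2)) + (norm (mat (trace W / 2) :: complex^(2 \<times> 2)^(2 \<times> 2)))\<^sup>2"
    by (simp add: power2_norm_eq_inner inner_diff_left inner_diff_right inner_commute algebra_simps)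
  also have "(norm W)\<^sup>2 = 4" using norm_unitary[OF assms] by simp
  also have "(norm (mat (trace W / 2) :: complex^(2 \<times> 2)^(2 \<times> 2)))\<^sup>2 = (cmod (trace W))\<^sup>2"
    by (simp add: mat_eq_diag_mat norm_diag_mat norm_divide power_divide)
  also have "W \<bullet> mat (trace W / 2) = (cmod (trace W))\<^sup>2 / 2"
    unfolding inner by (simp add: cmod_power2) (simp add: power2_eq_square)
  finally show ?thesis by simp
qed

text \<open>Laplace expansion along each of the four columns contributes one
  \<open>det R\<close>.\<close>

lemma sum_cofactor_mat:
  fixes R :: "complex^(2 \<times> 2)^(2 \<times> 2)"
  shows "(\<Sum>a\<in>UNIV. \<Sum>b\<in>UNIV. cofactor_mat R $ a $ b * R $ a $ b) = 4 * det R"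
  by (simp add: cofactor_mat_def det_2x2 sum_2x2) algebra

lemma norm_cofactor_realign_unitary:
  fixes U :: "complex^(2 \<times> 2)^(2 \<times> 2)"
  assumes U: "unitary U"
  shows "(norm (cofactor_mat (realign U)))\<^sup>2 \<le> 4 * cmod (det (realign U))"
proof -
  define K where "K = realign (cofactor_mat (realign U))"
  define C where "C = cofactor_mat U"
  define W where "W = spin_flip (transpose U) ** U"
  have W: "unitary W"
    unfolding W_def by (intro unitary_mult unitary_spin_flip unitary_transpose U)
  have "spin_flip (2 *\<^sub>R K - C) = U ** (W - mat (trace W / 2))"
    unfolding K_def C_def W_def cofactor_realign_identity[symmetric]
    by (simp add: vec_eq_iff spin_flip_def algebra_simps)
  then have "(norm (2 *\<^sub>R K - C))\<^sup>2 = 4"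
    using norm_minus_half_trace[OF W] norm_unitary_mult[OF U] norm_spin_flip by metis
  moreover have "(norm (2 *\<^sub>R K - C))\<^sup>2 = 4 * (norm K)\<^sup>2 - 4 * (K \<bullet> C) + (norm C)\<^sup>2"
    by (simp add: power2_norm_eq_inner inner_diff_left inner_diff_right inner_commute algebra_simps)
  moreover have "(norm C)\<^sup>2 = 4"
    using norm_cofactor_mat_right_inverse[of U "cadjoint U"] U norm_unitary[OF unitary_cadjoint[OF U]]
    by (simp add: C_def unitary_def cmod_det_unitary)
  \<comment> \<open>The preceding facts give \<open>(norm K)\<^sup>2 = K \<bullet> C\<close>, so
    this bound is all that remains.\<close>
  moreover have "K \<bullet> C \<le> 4 * cmod (det (realign U))"
  proof -
    have "K \<bullet> C = Re (\<Sum>a\<in>UNIV. \<Sum>b\<in>UNIV. cnj (C $ a $ b) * K $ a $ b)"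
      by (simp add: inner_vec_def inner_complex_def algebra_simps)
    also have "(\<Sum>a\<in>UNIV. \<Sum>b\<in>UNIV. cnj (C $ a $ b) * K $ a $ b)
      = cnj (det U) * (\<Sum>a\<in>UNIV. \<Sum>b\<in>UNIV. K $ a $ b * U $ a $ b)"
      by (simp add: C_def cofactor_mat_unitary[OF U] sum_distrib_left mult_ac)
    \<comment> \<open>Realignment permutes entries and is its own inverse, so it moves from one
      factor of the entrywise pairing to the other.\<close>
    also have "(\<Sum>a\<in>UNIV. \<Sum>b\<in>UNIV. K $ a $ b * U $ a $ b)
      = (\<Sum>a\<in>UNIV. \<Sum>b\<in>UNIV. cofactor_mat (realign U) $ a $ b * realign U $ a $ b)"
      by (simp add: K_def realign_def[of "cofactor_mat X" for X] realign_def[of U] sum_2x2)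
    also have "\<dots> = 4 * det (realign U)" by (rule sum_cofactor_mat)
    finally have "K \<bullet> C \<le> cmod (cnj (det U) * (4 * det (realign U)))"
      by (simp add: complex_Re_le_cmod del: times_complex.sel)
    then show ?thesis by (simp add: norm_mult cmod_det_unitary[OF U])
  qed
  ultimately show ?thesis by (simp add: K_def norm_realign)
qed

section \<open>Operator-Schmidt spectrum\<close>

definition vectorize :: "complex^2^2 \<Rightarrow> complex^(2 \<times> 2)" where
  "vectorize A = (\<chi> a. A $ fst a $ snd a)"

lemma hs_inner_eq_hinner: "hs_inner A B = hinner (vectorize A) (vectorize B)"
  by (simp add: hs_inner_def hinner_def vectorize_def trace_def matrix_matrix_mult_def sum_2x2 sum_2)

text \<open>The bijection \<open>q\<close> relabels the four operators by index pairs, so that their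
  vectorisations become the columns of a square matrix \<open>V\<close>. Orthonormality says that
  \<open>V\<close> is unitary, and \<open>cadjoint V *v vectorize M\<close> then gives the
  coefficients of any \<open>M\<close>.\<close>

lemma hs_orthonormal_basis_iff:
  fixes A :: "4 \<Rightarrow> complex^2^2" and q :: "2 \<times> 2 \<Rightarrow> 4"
  assumes q: "bij q"
  shows "hs_orthonormal_basis A \<longleftrightarrow> unitary (\<chi> a j. vectorize (A (q j)) $ a)"
proof -
  define V where "V = (\<chi> a j. vectorize (A (q j)) $ a)"
  have col: "column j V = vectorize (A (q j))" for j
    by (simp add: V_def column_def vec_eq_iff)
  have iff: "unitary V \<longleftrightarrow> (\<forall>j k. hs_inner (A j) (A k) = (if j = k then 1 else 0))"
  proof -
    have "unitary V \<longleftrightarrow> (\<forall>j k. hs_inner (A (q j)) (A (q k)) = (if q j = q k then 1 else 0))"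
      using bij_is_inj[OF q] by (simp add: unitary_columns_iff orthonormal_on_def col hs_inner_eq_hinner inj_eq)
    also have "\<dots> \<longleftrightarrow> (\<forall>j k. hs_inner (A j) (A k) = (if j = k then 1 else 0))"
      using bij_is_surj[OF q] by (metis surjD)
    finally show ?thesis .
  qed
  have "\<exists>c :: 4 \<Rightarrow> complex. M = (\<Sum>j\<in>UNIV. map_matrix ((*) (c j)) (A j))" if "unitary V" for M
  proof -
    define x where "x = cadjoint V *v vectorize M"
    have "vectorize M = V *v x"
      using that by (simp add: x_def matrix_vector_mul_assoc unitary_def)
    then have "vectorize M $ a = (\<Sum>j\<in>UNIV. x $ j * vectorize (A (q j)) $ a)" for a
      by (simp add: V_def matrix_vector_mult_def mult.commute)
    also have "(\<Sum>j\<in>UNIV. x $ j * vectorize (A (q j)) $ a) = (\<Sum>j\<in>UNIV. x $ inv q j * vectorize (A j) $ a)" for a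
      using sum.reindex_bij_betw[OF q, of "\<lambda>j. x $ inv q j * vectorize (A j) $ a"] bij_is_inj[OF q] by simp
    finally have M: "vectorize M $ a = (\<Sum>j\<in>UNIV. x $ inv q j * vectorize (A j) $ a)" for a .
    have "M $ i $ k = (\<Sum>j\<in>UNIV. x $ inv q j * A j $ i $ k)" for i k
      using M[of "(i, k)"] by (simp add: vectorize_def)
    then show ?thesis
      by (intro exI[of _ "\<lambda>j. x $ inv q j"]) (simp add: vec_eq_iff map_matrix_def)
  qed
  moreover have "hs_orthonormal_basis A \<longleftrightarrow> unitary V \<and>
      (\<forall>M. \<exists>c :: 4 \<Rightarrow> complex. M = (\<Sum>j\<in>UNIV. map_matrix ((*) (c j)) (A j)))"
    unfolding hs_orthonormal_basis_def iff ..
  ultimately show ?thesis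
    unfolding V_def[symmetric] by blast
qed

text \<open>Realignment sends \<open>kron A B\<close> to the outer product of the two
  vectorisations, without conjugation. A Schmidt decomposition is therefore a singular value
  decomposition of \<open>realign U\<close>, with a transpose on the right.\<close>

lemma op_schmidt_decomposition_iff:
  fixes q :: "2 \<times> 2 \<Rightarrow> 4"
  assumes q: "bij q"
  shows "op_schmidt_decomposition U l A B \<longleftrightarrow>
    (\<forall>j. l j \<ge> 0) \<and> unitary (\<chi> a j. vectorize (A (q j)) $ a) \<and>
    unitary (\<chi> a j. vectorize (B (q j)) $ a) \<and>
    realign U = (\<chi> a j. vectorize (A (q j)) $ a) ** diag_mat (\<lambda>j. of_real (l (q j))) **
      transpose (\<chi> a j. vectorize (B (q j)) $ a)"
proof -
  define R where "R = (\<chi> a j. vectorize (A (q j)) $ a) ** diag_mat (\<lambda>j. of_real (l (q j))) **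
      transpose (\<chi> a j. vectorize (B (q j)) $ a)"
  have R: "R $ a $ b = (\<Sum>j\<in>UNIV. vectorize (A j) $ a * of_real (l j) * vectorize (B j) $ b)" for a b
  proof -
    have "R $ a $ b = (\<Sum>j\<in>UNIV. vectorize (A (q j)) $ a * of_real (l (q j)) * vectorize (B (q j)) $ b)"
      unfolding R_def by (subst matrix_matrix_mult_def) (simp add: mult_diag_mat_nth transpose_def)
    also have "\<dots> = (\<Sum>j\<in>UNIV. vectorize (A j) $ a * of_real (l j) * vectorize (B j) $ b)"
      by (rule sum.reindex_bij_betw[OF q])
    finally show ?thesis .
  qed
  have "U = (\<Sum>j\<in>UNIV. l j *\<^sub>R kron (A j) (B j)) \<longleftrightarrow> realign U = R"
    by (auto simp: vec_eq_iff R realign_def vectorize_def kron_def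
        scaleR_conv_of_real[where 'a = complex] mult_ac)
  then show ?thesis
    by (simp add: op_schmidt_decomposition_def hs_orthonormal_basis_iff[OF q] R_def)
qed

lemma ex_bij_2x2: "\<exists>q :: 2 \<times> 2 \<Rightarrow> 4. bij q"
  by (intro finite_same_card_bij) auto

text \<open>A singular value decomposition of \<open>realign U\<close> is read back: columns of
  \<open>V\<close> and rows of \<open>W\<close>, reshaped to 2 by 2 matrices, are the
  operators.\<close>

lemma op_schmidt_decomposition_exists: "\<exists>l A B. op_schmidt_decomposition U l A B"
proof -
  obtain q :: "2 \<times> 2 \<Rightarrow> 4" where q: "bij q" using ex_bij_2x2 by blast
  obtain V W l where svd: "unitary V" "unitary W" "\<And>j. l j \<ge> 0"
    "realign U = V ** diag_mat (\<lambda>j. of_real (l j)) ** W"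
    using singular_value_decomposition[of "realign U"] by blast
  define p where "p = inv q"
  have p: "p (q j) = j" for j using bij_is_inj[OF q] by (simp add: p_def)
  define A where "A j = (\<chi> i k. V $ (i, k) $ p j)" for j
  define B where "B j = (\<chi> i k. W $ p j $ (i, k))" for j
  have "(\<chi> a j. vectorize (A (q j)) $ a) = V" "(\<chi> a j. vectorize (B (q j)) $ a) = transpose W"
    by (simp_all add: vectorize_def A_def B_def p vec_eq_iff transpose_def)
  then have "op_schmidt_decomposition U (\<lambda>j. l (p j)) A B"
    using svd by (simp add: op_schmidt_decomposition_iff[OF q] p unitary_transpose)
  then show ?thesis by blast
qed

lemma op_schmidt_decomposition_unique:
  assumes "op_schmidt_decomposition U l A B" "op_schmidt_decomposition U m C D"
  shows "image_mset (\<lambda>j. (l j)\<^sup>2) (mset_set UNIV) = image_mset (\<lambda>j. (m j)\<^sup>2) (mset_set UNIV)"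
proof -
  obtain q :: "2 \<times> 2 \<Rightarrow> 4" where q: "bij q" using ex_bij_2x2 by blast
  have reindex: "image_mset f (mset_set UNIV) = image_mset (\<lambda>j. f (q j)) (mset_set UNIV)" for f :: "4 \<Rightarrow> real"
    using image_mset_mset_set[OF bij_is_inj[OF q]] bij_is_surj[OF q]
    by (simp flip: multiset.map_comp[unfolded o_def])
  show ?thesis
    unfolding reindex
    using assms unfolding op_schmidt_decomposition_iff[OF q]
    by (intro singular_values_unique[of "\<chi> a j. vectorize (A (q j)) $ a"
          "transpose (\<chi> a j. vectorize (B (q j)) $ a)" "\<chi> a j. vectorize (C (q j)) $ a"
          "transpose (\<chi> a j. vectorize (D (q j)) $ a)"]) (auto intro: unitary_transpose)
qed

text \<open>Uniqueness discharges the definite description, so any decomposition computes the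
  spectrum.\<close>

lemma op_schmidt_spectrum_eq:
  assumes "op_schmidt_decomposition U l A B"
  shows "op_schmidt_spectrum U = image_mset (\<lambda>j. (l j)\<^sup>2 / 4) (mset_set UNIV)"
  unfolding op_schmidt_spectrum_def
proof (rule the_equality)
  show "\<exists>m C D. op_schmidt_decomposition U m C D \<and>
    image_mset (\<lambda>j. (l j)\<^sup>2 / 4) (mset_set UNIV) = image_mset (\<lambda>j. (m j)\<^sup>2 / 4) (mset_set UNIV)"
    using assms by blast
next
  fix M
  assume "\<exists>m C D. op_schmidt_decomposition U m C D \<and> M = image_mset (\<lambda>j. (m j)\<^sup>2 / 4) (mset_set UNIV)"
  then obtain m C D where m: "op_schmidt_decomposition U m C D"
    and M: "M = image_mset (\<lambda>j. (m j)\<^sup>2 / 4) (mset_set UNIV)" by blast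
  show "M = image_mset (\<lambda>j. (l j)\<^sup>2 / 4) (mset_set UNIV)"
    using arg_cong[OF op_schmidt_decomposition_unique[OF m assms], of "image_mset (\<lambda>x. x / 4)"]
    by (simp add: M multiset.map_comp o_def)
qed

section \<open>Symmetric-function bounds on the spectrum\<close>

lemma prod_UNIV_minus_reindex:
  fixes f :: "'b \<Rightarrow> real"
  assumes "bij q"
  shows "(\<Sum>j\<in>UNIV. \<Prod>k\<in>UNIV - {j}. f (q k)) = (\<Sum>j\<in>UNIV. \<Prod>k\<in>UNIV - {j}. f k)"
proof -
  have "bij_betw q (UNIV - {j}) (UNIV - {q j})" for j
    using bij_is_inj[OF assms] bij_is_surj[OF assms]
    by (simp add: bij_betw_def image_set_diff inj_on_diff)
  then have "(\<Prod>k\<in>UNIV - {j}. f (q k)) = (\<Prod>k\<in>UNIV - {q j}. f k)" for j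
    by (rule prod.reindex_bij_betw)
  then show ?thesis
    using sum.reindex_bij_betw[OF assms, of "\<lambda>j. \<Prod>k\<in>UNIV - {j}. f k"] by simp
qed

text \<open>Both facts concern \<open>realign U\<close>: its norm is that of \<open>U\<close>, and
  its cofactor norm and determinant are symmetric functions of its singular values
  \<open>l j\<close>.\<close>

lemma op_schmidt_decomposition_bounds:
  assumes U: "unitary U" and dec: "op_schmidt_decomposition U l A B"
  shows "(\<Sum>j\<in>UNIV. (l j)\<^sup>2) = 4"
    and "(\<Sum>j\<in>UNIV. \<Prod>k\<in>UNIV - {j}. (l k)\<^sup>2) \<le> 4 * (\<Prod>j\<in>UNIV. l j)"
proof -
  obtain q :: "2 \<times> 2 \<Rightarrow> 4" where q: "bij q" using ex_bij_2x2 by blast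
  define V where "V = (\<chi> a j. vectorize (A (q j)) $ a)"
  define W where "W = transpose (\<chi> a j. vectorize (B (q j)) $ a)"
  have l: "\<And>j. l j \<ge> 0" and V: "unitary V" and W: "unitary W"
    and R: "realign U = V ** diag_mat (\<lambda>j. of_real (l (q j))) ** W"
    using dec by (auto simp: op_schmidt_decomposition_iff[OF q] V_def W_def intro: unitary_transpose)
  have "(norm (realign U))\<^sup>2 = (\<Sum>j\<in>UNIV. (l (q j))\<^sup>2)"
    by (simp add: R norm_mult_unitary norm_unitary_mult V W norm_diag_mat)
  also have "\<dots> = (\<Sum>j\<in>UNIV. (l j)\<^sup>2)" by (rule sum.reindex_bij_betw[OF q])
  finally show "(\<Sum>j\<in>UNIV. (l j)\<^sup>2) = 4"
    using norm_unitary[OF U] by (simp add: norm_realign)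
  have "(\<Sum>j\<in>UNIV. \<Prod>k\<in>UNIV - {j}. (l k)\<^sup>2) = (norm (cofactor_mat (realign U)))\<^sup>2"
    using norm_cofactor_mat_singular_values[OF V W l R] prod_UNIV_minus_reindex[OF q, of "\<lambda>k. (l k)\<^sup>2"] by simp
  also have "\<dots> \<le> 4 * cmod (det (realign U))"
    by (rule norm_cofactor_realign_unitary[OF U])
  also have "cmod (det (realign U)) = (\<Prod>j\<in>UNIV. l (q j))"
    using l by (simp add: R det_mul norm_mult cmod_det_unitary V W det_diag_mat prod_norm[symmetric])
  also have "\<dots> = (\<Prod>j\<in>UNIV. l j)" by (rule prod.reindex_bij_betw[OF q])
  finally show "(\<Sum>j\<in>UNIV. \<Prod>k\<in>UNIV - {j}. (l k)\<^sup>2) \<le> 4 * (\<Prod>j\<in>UNIV. l j)" .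
qed

text \<open>With \<open>p j = (l j)\<^sup>2 / 4\<close>, the cofactor bound reads e3(p) \<le>
  (product of the \<open>l j\<close>) / 16, and the square of the right-hand side is e4(p).\<close>

lemma op_schmidt_spectrum_bounds:
  assumes "unitary U" and "op_schmidt_spectrum U = mset [a, b, c, d]"
  shows "a + b + c + d = 1" "a \<ge> 0" "b \<ge> 0" "c \<ge> 0" "d \<ge> 0"
    "(b * c * d + a * c * d + a * b * d + a * b * c)\<^sup>2 \<le> a * b * c * d"
proof -
  obtain l A B where dec: "op_schmidt_decomposition U l A B"
    using op_schmidt_decomposition_exists by blast
  define p where "p j = (l j)\<^sup>2 / 4" for j
  have M: "mset [a, b, c, d] = image_mset p (mset_set UNIV)"
    using assms(2) op_schmidt_spectrum_eq[OF dec] by (simp add: p_def[abs_def])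
  also have "\<dots> = mset [p 1, p 2, p 3, p 4]"
    unfolding UNIV_4 by simp
  finally have eq: "mset [a, b, c, d] = mset [p 1, p 2, p 3, p 4]" .
  have nonneg: "x \<ge> 0" if "x \<in># mset [a, b, c, d]" for x
    using that unfolding M by (auto simp: p_def)
  show "a \<ge> 0" "b \<ge> 0" "c \<ge> 0" "d \<ge> 0" by (auto intro: nonneg)
  have s: "UNIV - {1::4} = {2,3,4}" "UNIV - {2::4} = {1,3,4}" "UNIV - {3::4} = {1,2,4}" "UNIV - {4::4} = {1,2,3}"
    unfolding UNIV_4 by auto
  note bounds = op_schmidt_decomposition_bounds[OF assms(1) dec, unfolded sum_4 s]
  have "sum_mset (mset [a, b, c, d]) = 1"
    unfolding eq using bounds(1) by (simp add: p_def)
  then show "a + b + c + d = 1" by (simp add: add.assoc)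
  then have e1: "p 1 + p 2 + p 3 + p 4 = a + b + c + d"
    using bounds(1) by (simp add: p_def)
  \<comment> \<open>The multisets agree only up to order, so symmetric functions are compared
    through the polynomial with roots \<open>- a\<close>, \<open>- b\<close>, \<open>- c\<close>,
    \<open>- d\<close>.\<close>
  have P: "(a + t) * (b + t) * (c + t) * (d + t) = (p 1 + t) * (p 2 + t) * (p 3 + t) * (p 4 + t)" for t
  proof -
    have "prod_mset (image_mset (\<lambda>x. x + t) (mset [a, b, c, d])) =
        prod_mset (image_mset (\<lambda>x. x + t) (mset [p 1, p 2, p 3, p 4]))"
      by (simp only: eq)
    then show ?thesis by (simp add: mult.assoc)
  qed
  \<comment> \<open>For the monic quartic f in \<open>P\<close>, (f(1) - f(-1)) / 2 = e1 + e3, which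
    isolates e3 once e1 is known.\<close>
  have e3_eq: "w * y * z + x * y * z + x * w * z + x * w * y
      = ((x + 1) * (w + 1) * (y + 1) * (z + 1) - (x + - 1) * (w + - 1) * (y + - 1) * (z + - 1)) / 2 - (x + w + y + z)"
    for x y z w :: real
    by (simp add: field_simps)
  have e3: "b * c * d + a * c * d + a * b * d + a * b * c
      = p 2 * p 3 * p 4 + p 1 * p 3 * p 4 + p 1 * p 2 * p 4 + p 1 * p 2 * p 3"
    unfolding e3_eq[of b c d a] e3_eq[of "p 2" "p 3" "p 4" "p 1"]
    using P[of 1] P[of "-1"] e1 by simp
  have "p 2 * p 3 * p 4 + p 1 * p 3 * p 4 + p 1 * p 2 * p 4 + p 1 * p 2 * p 3
      = (\<Sum>j\<in>UNIV. \<Prod>k\<in>UNIV - {j}. (l k)\<^sup>2) / 64"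
    unfolding sum_4 s by (simp add: p_def)
  also have "\<dots> \<le> (\<Prod>j\<in>UNIV. l j) / 16"
    using op_schmidt_decomposition_bounds(2)[OF assms(1) dec] by simp
  finally have "(b * c * d + a * c * d + a * b * d + a * b * c)\<^sup>2 \<le> ((\<Prod>j\<in>UNIV. l j) / 16)\<^sup>2"
    unfolding e3 by (intro power_mono) (simp_all add: p_def)
  also have "\<dots> = p 1 * p 2 * p 3 * p 4"
    unfolding UNIV_4 by (simp add: p_def power_mult_distrib power_divide mult.assoc)
  also have "\<dots> = a * b * c * d"
    using P[of 0] by simp
  finally show "(b * c * d + a * c * d + a * b * d + a * b * c)\<^sup>2 \<le> a * b * c * d" .
qed

section \<open>From symmetric functions to the ordered spectrum\<close>

lemma ordered_product_inequality:
  fixes a b c d :: real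
  assumes ord: "a \<ge> b" "b \<ge> c" "c \<ge> d" "d \<ge> 0" and sum: "a + b + c + d = 1"
    and le: "(b * c * d + a * c * d + a * b * d + a * b * c)\<^sup>2 \<le> a * b * c * d"
  shows "a * d \<ge> b * c"
proof (rule ccontr)
  assume neg: "\<not> a * d \<ge> b * c"
  have "(a * b - c * d) * (a * c - b * d) * (a * d - b * c)
    = (a + b + c + d)\<^sup>2 * (a * b * c * d) - (b * c * d + a * c * d + a * b * d + a * b * c)\<^sup>2"
    by (simp add: power2_eq_square algebra_simps)
  then have prod: "(a * b - c * d) * (a * c - b * d) * (a * d - b * c) \<ge> 0"
    using le sum by simp
  have "a * d \<ge> 0" using ord by (intro mult_nonneg_nonneg) auto
  then have "c \<noteq> 0" using neg by auto
  then have pos: "a > 0" "b > 0" "c > 0" using ord by auto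
  \<comment> \<open>The chain \<open>b * d \<le> a * d < b * c\<close> yields the strict gap
    \<open>d < c\<close> that makes both remaining factors positive.\<close>
  have "b * d < b * c"
    using neg mult_right_mono[OF ord(1) ord(4)] by linarith
  then have cd: "d < c" using pos by simp
  have "a * c \<ge> b * c" using ord pos by (intro mult_right_mono) auto
  then have ac: "a * c > b * d" using \<open>b * d < b * c\<close> by linarith
  have "a * b \<ge> c * b" using ord pos by (intro mult_right_mono) auto
  moreover have "c * b > c * d" using cd ord pos by (intro mult_strict_left_mono) auto
  ultimately have ab: "a * b > c * d" by linarith
  have "(a * b - c * d) * (a * c - b * d) * (a * d - b * c) < 0"
    using ab ac neg by (intro mult_pos_neg mult_pos_pos) auto
  then show False using prod by simp
qed


text \<open>Some decomposition exists, so the spectrum has exactly four elements and the reversed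
  sorted list can be named entry by entry.\<close>

lemma op_schmidt_spectrum_sorted:
  obtains a b c d where "op_schmidt_spectrum U = mset [a, b, c, d]" "a \<ge> b" "b \<ge> c" "c \<ge> d"
    "op_schmidt_prob U 1 = a" "op_schmidt_prob U 2 = b" "op_schmidt_prob U 3 = c" "op_schmidt_prob U 4 = d"
proof -
  obtain l A B where dec: "op_schmidt_decomposition U l A B"
    using op_schmidt_decomposition_exists by blast
  define xs where "xs = rev (sorted_list_of_multiset (op_schmidt_spectrum U))"
  have M: "mset xs = op_schmidt_spectrum U" by (simp add: xs_def)
  have "size (mset xs) = 4"
    unfolding M op_schmidt_spectrum_eq[OF dec] by simp
  then obtain a b c d where xs: "xs = [a, b, c, d]"
    by (auto simp: length_Suc_conv numeral_eq_Suc)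
  have "sorted (rev xs)" by (simp add: xs_def)
  then have ord: "a \<ge> b" "b \<ge> c" "c \<ge> d" by (simp_all add: xs)
  \<comment> \<open>Ranks count from 1 and list positions from 0.\<close>
  have "op_schmidt_prob U j = xs ! (j - 1)" for j by (simp add: op_schmidt_prob_def xs_def)
  then show ?thesis
    using that[of a b c d] M ord by (simp add: xs numeral_eq_Suc)
qed

theorem lemma1:
  shows "(\<forall>U :: complex^(2 \<times> 2)^(2 \<times> 2). unitary U \<longrightarrow>
            op_schmidt_prob U 1 * op_schmidt_prob U 4 \<ge> op_schmidt_prob U 2 * op_schmidt_prob U 3) \<and>
         \<not> (\<exists>U :: complex^(2 \<times> 2)^(2 \<times> 2). unitary U \<and> op_schmidt_rank U = 3)"
proof (intro conjI allI impI notI)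
  fix U :: "complex^(2 \<times> 2)^(2 \<times> 2)"
  assume U: "unitary U"
  obtain a b c d where s: "op_schmidt_spectrum U = mset [a, b, c, d]" "a \<ge> b" "b \<ge> c" "c \<ge> d"
    "op_schmidt_prob U 1 = a" "op_schmidt_prob U 2 = b" "op_schmidt_prob U 3 = c" "op_schmidt_prob U 4 = d"
    by (rule op_schmidt_spectrum_sorted)
  show "op_schmidt_prob U 1 * op_schmidt_prob U 4 \<ge> op_schmidt_prob U 2 * op_schmidt_prob U 3"
    unfolding s using op_schmidt_spectrum_bounds[OF U s(1)] s(2-4)
    by (intro ordered_product_inequality) auto
next
  assume "\<exists>U :: complex^(2 \<times> 2)^(2 \<times> 2). unitary U \<and> op_schmidt_rank U = 3"
  then obtain U :: "complex^(2 \<times> 2)^(2 \<times> 2)" where U: "unitary U" and rank: "op_schmidt_rank U = 3"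
    by blast
  obtain a b c d where s: "op_schmidt_spectrum U = mset [a, b, c, d]" "a \<ge> b" "b \<ge> c" "c \<ge> d"
    by (rule op_schmidt_spectrum_sorted)
  note bounds = op_schmidt_spectrum_bounds[OF U s(1)]
  have le: "a * d \<ge> b * c"
    using bounds s by (intro ordered_product_inequality) auto
  have size: "size (filter_mset (\<lambda>p. p \<noteq> 0) (mset [a, b, c, d])) = 3"
    using rank by (simp add: op_schmidt_rank_def s)
  \<comment> \<open>If \<open>c\<close> vanished, so would \<open>d\<close>, leaving at most two
    nonzero elements.\<close>
  have "c \<noteq> 0"
  proof
    assume "c = 0"
    then have "d = 0" using s bounds by simp
    then show False using size \<open>c = 0\<close> by (simp split: if_splits)
  qed
  then have pos: "a > 0" "b > 0" "c > 0" using s bounds by auto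
  \<comment> \<open>The three positive elements already account for the rank, and then
    \<open>a * d = 0 < b * c\<close> contradicts the inequality.\<close>
  have "d = 0"
    using size pos by (simp split: if_splits)
  then show False using le mult_pos_pos[OF pos(2,3)] by simp
qed

end
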